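(* Let $p$ be a prime, and put $\mathbf{p}=p$ if $p$ is odd and $\mathbf{p}=4$ if $p=2$. Let $G$ be a finite group such that $K=\langle x\in G\mid x^{\mathbf{p}}=1\rangle\leq Z_n(G)$ for some $n\geq 1$. Then $G$ is $p$-nilpotent.
   Context: $Z_n(G)$ denotes the $n$-th term of the upper central series of $G$ (with $Z_1(G)=Z(G)$ the center). $G$ is $p$-nilpotent if a Sylow $p$-subgroup $P$ of $G$ has a normal complement in $G$, i.e. there is a normal subgroup $N$ of $G$ with $G=NP$ and $N\cap P=1$. *)

theory Defs
  imports "HOL-Algebra.Algebra"
begin

definition center :: "('a, 'b) monoid_scheme \<Rightarrow> 'a set" where
  "center G = {x \<in> carrier G. \<forall>g \<in> carrier G. x \<otimes>\<^bsub>G\<^esub> g = g \<otimes>\<^bsub>G\<^esub> x}"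

text \<open>The recursion is the usual one: \<open>Z\<^sub>0 = 1\<close>, and \<open>Z\<^sub>n\<^sub>+\<^sub>1\<close> is the full preimage of the
  center of the quotient of \<open>G\<close> by \<open>Z\<^sub>n\<close>.\<close>

fun upper_central :: "('a, 'b) monoid_scheme \<Rightarrow> nat \<Rightarrow> 'a set" where
  "upper_central G 0 = {\<one>\<^bsub>G\<^esub>}"
| "upper_central G (Suc n) =
     {x \<in> carrier G. upper_central G n #>\<^bsub>G\<^esub> x \<in> center (G Mod upper_central G n)}"

definition sylow_subgroup :: "nat \<Rightarrow> 'a set \<Rightarrow> ('a, 'b) monoid_scheme \<Rightarrow> bool" where
  "sylow_subgroup p P G \<longleftrightarrow> subgroup P G \<and> card P = p ^ multiplicity p (order G)"

definition p_nilpotent :: "nat \<Rightarrow> ('a, 'b) monoid_scheme \<Rightarrow> bool" where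
  "p_nilpotent p G \<longleftrightarrow>
     (\<exists>P N. sylow_subgroup p P G \<and> N \<lhd> G \<and>
        N <#>\<^bsub>G\<^esub> P = carrier G \<and> N \<inter> P = {\<one>\<^bsub>G\<^esub>})"

definition bold_p :: "nat \<Rightarrow> nat" where
  "bold_p p = (if p = 2 then 4 else p)"

lemma (in group) preimage_center_iff:
  assumes "N \<lhd> G" "x \<in> carrier G"
  shows "N #> x \<in> center (G Mod N) \<longleftrightarrow>
           (\<forall>g \<in> carrier G. N #> (x \<otimes> g) = N #> (g \<otimes> x))"
  using assms
  by (auto simp: center_def FactGroup_def RCOSETS_def normal.rcos_sum)

lemma (in group) upper_central_normal: "upper_central G n \<lhd> G"
proof (induction n)
  case 0
  then show ?case by (simp add: one_is_normal)
next
  case (Suc n)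
  define N where "N = upper_central G n"
  interpret N: normal N G using Suc by (simp add: N_def)
  interpret Q: group "G Mod N" by (rule N.factorgroup_is_group)
  define q where "q = (\<lambda>x. N #> x)"
  let ?Z = "upper_central G (Suc n)"
  have Z: "?Z = {x \<in> carrier G. \<forall>g \<in> carrier G. N #> (x \<otimes> g) = N #> (g \<otimes> x)}"
    using preimage_center_iff[OF N.normal_axioms] by (auto simp: N_def)
  have hom: "q \<in> hom G (G Mod N)" unfolding q_def by (rule N.r_coset_hom_Mod)
  interpret h: group_hom G "G Mod N" q
    using hom by unfold_locales
  have memZ: "x \<in> ?Z \<longleftrightarrow> x \<in> carrier G \<and> (\<forall>g \<in> carrier G.
      q x \<otimes>\<^bsub>G Mod N\<^esub> q g = q g \<otimes>\<^bsub>G Mod N\<^esub> q x)" for x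
  proof -
    have "q (x \<otimes> g) = q x \<otimes>\<^bsub>G Mod N\<^esub> q g" "q (g \<otimes> x) = q g \<otimes>\<^bsub>G Mod N\<^esub> q x"
      if "x \<in> carrier G" "g \<in> carrier G" for g
      using that h.hom_mult by blast+
    then show ?thesis unfolding Z q_def[symmetric] by (auto simp: q_def)
  qed
  have sub: "subgroup ?Z G"
  proof (rule subgroupI)
    show "?Z \<subseteq> carrier G" using memZ by blast
    have "\<one> \<in> ?Z" by (simp add: Z del: upper_central.simps)
    then show "?Z \<noteq> {}" by blast
  next
    fix a assume a: "a \<in> ?Z"
    have aG: "a \<in> carrier G" using a memZ by blast
    have "q (inv a) \<otimes>\<^bsub>G Mod N\<^esub> q g = q g \<otimes>\<^bsub>G Mod N\<^esub> q (inv a)" if "g \<in> carrier G" for g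
    proof -
      have c: "q a \<otimes>\<^bsub>G Mod N\<^esub> q g = q g \<otimes>\<^bsub>G Mod N\<^esub> q a" using a that memZ by blast
      have A: "q a \<in> carrier (G Mod N)" "q g \<in> carrier (G Mod N)"
        using aG that by (auto intro: h.hom_closed)
      have "inv\<^bsub>G Mod N\<^esub> q a \<otimes>\<^bsub>G Mod N\<^esub> q g = q g \<otimes>\<^bsub>G Mod N\<^esub> inv\<^bsub>G Mod N\<^esub> q a"
        using A c Q.inv_solve_left Q.inv_solve_right Q.m_assoc Q.m_closed Q.inv_closed by metis
      then show ?thesis using h.hom_inv[OF aG] by metis
    qed
    then show "inv a \<in> ?Z" using memZ aG inv_closed by blast
  next
    fix a b assume ab: "a \<in> ?Z" "b \<in> ?Z"
    have G: "a \<in> carrier G" "b \<in> carrier G" using ab memZ by blast+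
    have "q (a \<otimes> b) \<otimes>\<^bsub>G Mod N\<^esub> q g = q g \<otimes>\<^bsub>G Mod N\<^esub> q (a \<otimes> b)" if "g \<in> carrier G" for g
    proof -
      have "q a \<otimes>\<^bsub>G Mod N\<^esub> q g = q g \<otimes>\<^bsub>G Mod N\<^esub> q a"
           "q b \<otimes>\<^bsub>G Mod N\<^esub> q g = q g \<otimes>\<^bsub>G Mod N\<^esub> q b"
        using ab that memZ by blast+
      moreover have "q a \<in> carrier (G Mod N)" "q b \<in> carrier (G Mod N)" "q g \<in> carrier (G Mod N)"
        using G that by (auto intro: h.hom_closed)
      ultimately show ?thesis using h.hom_mult[OF G] Q.m_assoc by metis
    qed
    then show "a \<otimes> b \<in> ?Z" using memZ G m_closed by blast
  qed
  have "x \<otimes> z \<otimes> inv x \<in> ?Z" if x: "x \<in> carrier G" and "z \<in> ?Z" for x z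
  proof -
    have z: "z \<in> carrier G" using that memZ by blast
    have c: "q z \<otimes>\<^bsub>G Mod N\<^esub> q x = q x \<otimes>\<^bsub>G Mod N\<^esub> q z" using that memZ by blast
    have A: "q x \<in> carrier (G Mod N)" "q z \<in> carrier (G Mod N)"
      using x z by (auto intro: h.hom_closed)
    have "q (x \<otimes> z \<otimes> inv x) = (q x \<otimes>\<^bsub>G Mod N\<^esub> q z) \<otimes>\<^bsub>G Mod N\<^esub> inv\<^bsub>G Mod N\<^esub> q x"
      using x z h.hom_mult h.hom_inv m_closed inv_closed by metis
    also have "\<dots> = q z" using c A Q.inv_solve_right' Q.m_closed by metis
    finally show ?thesis using that z memZ m_closed inv_closed by metis
  qed
  then show ?case using sub normal_inv_iff by blast
qed

lemma (in group) upper_central_1: "upper_central G 1 = center G"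
proof -
  have "{\<one>} #> y = {y}" if "y \<in> carrier G" for y
    using that by (simp add: r_coset_def)
  then have "{\<one>} #> x \<in> center (G Mod {\<one>}) \<longleftrightarrow> (\<forall>g \<in> carrier G. x \<otimes> g = g \<otimes> x)"
    if "x \<in> carrier G" for x
    using preimage_center_iff[OF one_is_normal that] that by simp
  then show ?thesis
    unfolding One_nat_def upper_central.simps center_def[of G] by blast
qed

end

theory Submission
  imports Defs
begin

text \<open>
  Let \<open>K\<close> be the subgroup of \<open>G\<close> generated by the elements of order prime to \<open>p\<close>. It is normal and
  contains every \<open>q\<close>-subgroup for primes \<open>q\<close> other than \<open>p\<close>, so it complements a Sylow \<open>p\<close>-subgroup
  of \<open>G\<close> as soon as \<open>p\<close> does not divide its order (\<open>p_nilpotent_if_normal_p'_subgroup\<close>).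

  A hypercentral element of \<open>p\<close>-power order commutes with all elements of order prime to \<open>p\<close>
  (\<open>coprime_exponents_commute_in_upper_central\<close>). Hence the elements \<open>x\<close> with \<open>x [^] bold_p p = \<one>\<close> of
  \<open>K\<close> are central in \<open>K\<close>. Suppose that \<open>p\<close> divides the order of \<open>K\<close> and let \<open>P\<close> be a Sylow
  \<open>p\<close>-subgroup of \<open>K\<close>, of exponent \<open>p ^ Suc i\<close>. The heart of the proof is that \<open>x \<mapsto> x [^] (p ^ i)\<close>
  is a homomorphism on \<open>P\<close> (\<open>pow_mult_distrib_if_bold_p_central\<close>). Its values have order dividing \<open>p\<close>
  and are central in \<open>K\<close>, so it takes equal values at elements of \<open>P\<close> that are conjugate in \<open>K\<close>.
  For such a homomorphism the transfer to \<open>K\<close> agrees on \<open>P\<close> with its power by the index of \<open>P\<close>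
  (\<open>transfer\<close>), which is prime to \<open>p\<close>. So \<open>K\<close> has a nontrivial homomorphism to an elementary
  abelian \<open>p\<close>-group, although it is generated by elements of order prime to \<open>p\<close>: a contradiction.

  That powers are homomorphisms on \<open>P\<close> rests on the fact that elements with the same \<open>p\<close>-th power
  differ by an element of order dividing \<open>p\<close> (\<open>pow_eq_imp_quotient_pow\<close>). It implies that the
  hypothesis on \<open>P\<close> is inherited by the quotient of \<open>P\<close> by its elements of order dividing \<open>p\<close>
  (\<open>bold_p_central_pow_preimage\<close>), which allows an induction on \<open>i\<close>.
\<close>

section \<open>Commutators modulo the center\<close>

lemma center_carrier: "x \<in> center G \<Longrightarrow> x \<in> carrier G"
  by (simp add: center_def)

lemma center_commute: "x \<in> center G \<Longrightarrow> g \<in> carrier G \<Longrightarrow> x \<otimes>\<^bsub>G\<^esub> g = g \<otimes>\<^bsub>G\<^esub> x"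
  by (simp add: center_def)

lemma (in group) subgroup_center: "subgroup (center G) G"
  using upper_central_normal[of 1] upper_central_1 normal_imp_subgroup by metis

lemma (in group) center_nat_pow: "c \<in> center G \<Longrightarrow> c [^] (n :: nat) \<in> center G"
  by (induction n) (auto simp: subgroup.one_closed subgroup.m_closed subgroup_center)

context group
begin

context
  fixes a b c
  assumes a: "a \<in> carrier G" and b: "b \<in> carrier G" and c: "c \<in> center G"
    and ba: "b \<otimes> a = c \<otimes> (a \<otimes> b)"
begin

text \<open>Here \<open>c\<close> is the commutator of \<open>b\<close> and \<open>a\<close>. Since it is central, each of the \<open>n\<close> factors \<open>b\<close> that
  moves past \<open>a\<close> contributes one copy of \<open>c\<close>.\<close>

lemma pow_swap_central_commutator: "b [^] (n :: nat) \<otimes> a = c [^] n \<otimes> (a \<otimes> b [^] n)"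
proof (induction n)
  case 0
  then show ?case using a by simp
next
  case (Suc n)
  have cG: "c \<in> carrier G" using c by (rule center_carrier)
  have "b [^] Suc n \<otimes> a = b [^] n \<otimes> (c \<otimes> (a \<otimes> b))" using a b ba by (simp add: m_assoc)
  also have "\<dots> = c \<otimes> (b [^] n \<otimes> a) \<otimes> b"
    using a b cG center_commute[OF c, of "b [^] n"] by (simp add: m_assoc[symmetric])
  also have "\<dots> = c [^] Suc n \<otimes> (a \<otimes> b [^] Suc n)"
    using a b cG nat_pow_Suc2[of c n] by (simp add: Suc m_assoc)
  finally show ?case .
qed

text \<open>Collecting the factors of \<open>(a \<otimes> b) [^] n\<close> moves a \<open>b\<close> past an \<open>a\<close> once for every pair of the \<open>n\<close>
  factors, hence the exponent \<open>n choose 2\<close>.\<close>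

lemma mult_pow_central_commutator:
  "(a \<otimes> b) [^] (n :: nat) = c [^] (n choose 2) \<otimes> (a [^] n \<otimes> b [^] n)"
proof (induction n)
  case 0
  then show ?case by (simp add: binomial_eq_0)
next
  case (Suc n)
  have cG: "c \<in> carrier G" using c by (rule center_carrier)
  have "(a \<otimes> b) [^] Suc n = c [^] (n choose 2) \<otimes> (a [^] n \<otimes> (b [^] n \<otimes> a) \<otimes> b)"
    using a b cG by (simp add: Suc m_assoc)
  also have "\<dots> = c [^] (n choose 2) \<otimes> ((a [^] n \<otimes> c [^] n) \<otimes> a \<otimes> b [^] n \<otimes> b)"
    using a b cG by (simp add: pow_swap_central_commutator m_assoc)
  also have "a [^] n \<otimes> c [^] n = c [^] n \<otimes> a [^] n"
    using a center_nat_pow[OF c] by (simp add: center_commute)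
  also have "c [^] (n choose 2) \<otimes> (c [^] n \<otimes> a [^] n \<otimes> a \<otimes> b [^] n \<otimes> b)
      = (c [^] (n choose 2) \<otimes> c [^] n) \<otimes> (a [^] Suc n \<otimes> b [^] Suc n)"
    using a b cG by (simp add: m_assoc)
  also have "c [^] (n choose 2) \<otimes> c [^] n = c [^] (Suc n choose 2)"
    using cG by (simp add: nat_pow_mult numeral_2_eq_2 add.commute)
  finally show ?case .
qed

text \<open>Bilinearity of a central commutator gives \<open>c [^] s = c [^] m = \<one>\<close>.\<close>

lemma coprime_central_commutator_trivial:
  assumes "a [^] (s :: nat) = \<one>" "b [^] (m :: nat) = \<one>" "coprime s m"
  shows "c = \<one>"
proof -
  have cG: "c \<in> carrier G" using c by (rule center_carrier)
  have "c [^] m \<otimes> a = a" using pow_swap_central_commutator[of m] a assms(2) by simp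
  then have m: "c [^] m = \<one>" using a cG by (simp add: r_cancel_one)
  have ci: "inv c \<in> center G" using c subgroup.m_inv_closed[OF subgroup_center] by blast
  have "a \<otimes> b = inv c \<otimes> (b \<otimes> a)" using ba a b cG by (simp add: m_assoc[symmetric])
  from group.pow_swap_central_commutator[OF is_group b a ci this, of s]
  have "inv c [^] s = \<one>" using assms(1) b cG by (simp add: r_cancel_one)
  then have s: "c [^] s = \<one>" using cG by (metis nat_pow_inv inv_eq_1_iff nat_pow_closed)
  have "ord c dvd s" "ord c dvd m" using s m cG pow_eq_id by blast+
  then have "ord c = 1" using assms(3) by (metis coprime_common_divisor_nat)
  then show ?thesis using cG by (metis ord_eq_1)
qed

end

lemma pow_conj:
  assumes "g \<in> carrier G" "x \<in> carrier G"
  shows "(g \<otimes> x \<otimes> inv g) [^] (n :: nat) = g \<otimes> x [^] n \<otimes> inv g"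
proof (induction n)
  case (Suc n)
  have "(g \<otimes> x \<otimes> inv g) [^] Suc n = g \<otimes> x [^] n \<otimes> (inv g \<otimes> g) \<otimes> x \<otimes> inv g"
    unfolding nat_pow_Suc Suc using assms by (simp only: m_assoc m_closed inv_closed nat_pow_closed)
  then show ?case using assms by (simp add: m_assoc)
qed (use assms in simp)

section \<open>Cosets and the upper central series\<close>

lemma coset_eq_iff:
  assumes "subgroup N G" "x \<in> carrier G" "y \<in> carrier G"
  shows "N #> x = N #> y \<longleftrightarrow> x \<otimes> inv y \<in> N"
proof
  assume "N #> x = N #> y"
  then have "x \<in> N #> y" using rcos_self assms by metis
  then show "x \<otimes> inv y \<in> N" using subgroup.rcos_module_imp[OF assms(1) is_group assms(3)] by simp
next
  assume "x \<otimes> inv y \<in> N"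
  then have "x \<in> N #> y" using assms(2,3) by (auto simp: r_coset_def m_assoc intro!: bexI[of _ "x \<otimes> inv y"])
  then show "N #> x = N #> y" using repr_independence assms by metis
qed

lemma coset_eq_one_iff:
  assumes "N \<lhd> G" "x \<in> carrier G"
  shows "N #> x = \<one>\<^bsub>G Mod N\<^esub> \<longleftrightarrow> x \<in> N"
  using coset_join1 coset_join2 assms normal_imp_subgroup by (metis one_FactGroup)

lemma coset_group_hom: "N \<lhd> G \<Longrightarrow> group_hom G (G Mod N) (\<lambda>x. N #> x)"
  by (simp add: group_hom_def group_hom_axioms_def normal.factorgroup_is_group normal.r_coset_hom_Mod is_group)

lemma mem_carrier_Mod: "U \<in> carrier (G Mod N) \<longleftrightarrow> (\<exists>x \<in> carrier G. U = N #> x)"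
  by (auto simp: FactGroup_def RCOSETS_def)

lemma mem_upper_central_Suc:
  "x \<in> upper_central G (Suc n) \<longleftrightarrow>
     x \<in> carrier G \<and> (\<forall>g \<in> carrier G. x \<otimes> g \<otimes> inv (g \<otimes> x) \<in> upper_central G n)"
  using preimage_center_iff[OF upper_central_normal] coset_eq_iff[OF normal_imp_subgroup[OF upper_central_normal]]
  by auto

end

section \<open>Finite p-groups are nilpotent\<close>

text \<open>The class equation: a conjugacy class has one element if it lies in the center and otherwise a
  multiple of \<open>p\<close> elements, so \<open>p\<close> divides the order of the center.\<close>

lemma (in group) center_nontrivial:
  assumes "Factorial_Ring.prime p" "finite (carrier G)" "order G = p ^ a" "a > 0"
  shows "\<exists>z \<in> center G. z \<noteq> \<one>"
proof -
  define \<phi> where "\<phi> = (\<lambda>g. \<lambda>h \<in> carrier G. g \<otimes> h \<otimes> inv g)"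
  interpret act: group_action G "carrier G" \<phi>
    unfolding \<phi>_def by (rule action_by_conjugation)
  let ?O = "\<lambda>x. orbit G \<phi> x"
  have O: "?O x = {g \<otimes> x \<otimes> inv g |g. g \<in> carrier G}" if "x \<in> carrier G" for x
    using that by (simp add: orbit_def \<phi>_def)
  have dvd: "p dvd card (?O x)" if x: "x \<in> carrier G" "x \<notin> center G" for x
  proof -
    have "card (?O x) dvd p ^ a"
      using act.orbit_stabilizer_theorem[OF x(1)] assms(3) by (metis dvd_triv_left)
    then obtain k where k: "card (?O x) = p ^ k" using assms(1) divides_primepow_nat by blast
    have "k \<noteq> 0"
    proof
      assume "k = 0"
      then obtain y where y: "?O x = {y}" using k card_1_singletonE by auto
      have "g \<otimes> x \<otimes> inv g = x" if g: "g \<in> carrier G" for g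
      proof -
        have "g \<otimes> x \<otimes> inv g \<in> ?O x" "\<one> \<otimes> x \<otimes> inv \<one> \<in> ?O x" using g O x by blast+
        then show ?thesis using y x by simp
      qed
      then have "x \<otimes> g = g \<otimes> x" if "g \<in> carrier G" for g
        using that x by (metis inv_solve_right' m_closed)
      then show False using x by (auto simp: center_def)
    qed
    then show ?thesis using k by simp
  qed
  have single: "?O x = {x}" if "x \<in> center G" for x
  proof -
    have fixed: "g \<otimes> x \<otimes> inv g = x" if "g \<in> carrier G" for g
      using that \<open>x \<in> center G\<close> center_carrier[of x G] center_commute[of x G g]
      by (metis inv_solve_right' m_closed)
    then have "{g \<otimes> x \<otimes> inv g |g. g \<in> carrier G} = {x}" using one_closed by force
    then show ?thesis using O[OF center_carrier[OF \<open>x \<in> center G\<close>]] by simp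
  qed
  define \<O> where "\<O> = orbits G (carrier G) \<phi>"
  define \<S> where "\<S> = (\<lambda>x. {x}) ` center G"
  have zsub: "\<S> \<subseteq> \<O>"
    unfolding \<S>_def \<O>_def orbits_def using single center_carrier by fastforce
  have finO: "finite \<O>" unfolding \<O>_def orbits_def using assms(2) by auto
  have rest: "p dvd card U" if U: "U \<in> \<O> - \<S>" for U
  proof -
    obtain x where x: "x \<in> carrier G" "U = ?O x" using U by (auto simp: \<O>_def orbits_def)
    then have "x \<notin> center G" using U single by (auto simp: \<S>_def)
    then show ?thesis using dvd x by simp
  qed
  have "(\<Sum>U\<in>\<O>. card U) = order G"
    using act.disjoint_sum[OF assms(2), of "\<lambda>_. 1::nat"] by (simp add: \<O>_def order_def)
  moreover have "(\<Sum>U\<in>\<O>. card U) = (\<Sum>U\<in>\<O> - \<S>. card U) + (\<Sum>U\<in>\<S>. card U)"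
    using zsub finO by (rule sum.subset_diff)
  moreover have "(\<Sum>U\<in>\<S>. card U) = card (center G)"
    unfolding \<S>_def by (simp add: sum.reindex)
  moreover have "p dvd (\<Sum>U\<in>\<O> - \<S>. card U)" using rest by (rule dvd_sum)
  moreover have "p dvd order G" using assms by simp
  ultimately have "p dvd card (center G)" using dvd_add_right_iff[of p "sum card (\<O> - \<S>)" "card (center G)"] by simp
  moreover have "\<one> \<in> center G" by (rule subgroup.one_closed[OF subgroup_center])
  moreover have "\<not> p dvd 1" using assms(1) by auto
  ultimately have "center G \<noteq> {\<one>}" by auto
  then show ?thesis using \<open>\<one> \<in> center G\<close> by blast
qed

lemma (in group) p_group_quotient:
  assumes "Factorial_Ring.prime p" "finite (carrier G)" "order G = p ^ a" "N \<lhd> G"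
  shows "finite (carrier (G Mod N)) \<and> (\<exists>b. order (G Mod N) = p ^ b)"
proof -
  have "card (rcosets N) * card N = p ^ a"
    using lagrange[OF normal_imp_subgroup[OF assms(4)]] assms(3) by simp
  then have "\<exists>b. card (rcosets N) = p ^ b"
    using assms(1) divides_primepow_nat by (metis dvd_triv_left)
  moreover have "finite (rcosets N)" using assms(2) by (simp add: RCOSETS_def)
  ultimately show ?thesis by (simp add: order_def FactGroup_def)
qed

text \<open>A proper term of the upper central series has a nontrivial \<open>p\<close>-group as quotient, so the next
  term is strictly larger; a finite group cannot grow forever.\<close>

lemma (in group) p_group_nilpotent:
  assumes "Factorial_Ring.prime p" "finite (carrier G)" "order G = p ^ a"
  shows "\<exists>n. upper_central G n = carrier G"
proof (rule ccontr)
  assume neg: "\<nexists>n. upper_central G n = carrier G"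
  have sub: "upper_central G n \<subseteq> carrier G" for n
    using normal_imp_subgroup[OF upper_central_normal] subgroup.subset by blast
  have grow: "card (upper_central G n) \<ge> n" for n
  proof (induction n)
    case (Suc n)
    let ?Z = "upper_central G n"
    interpret Q: group "G Mod ?Z" using upper_central_normal by (rule normal.factorgroup_is_group)
    interpret q: group_hom G "G Mod ?Z" "\<lambda>x. ?Z #> x" using upper_central_normal by (rule coset_group_hom)
    obtain b where b: "finite (carrier (G Mod ?Z))" "order (G Mod ?Z) = p ^ b"
      using p_group_quotient[OF assms upper_central_normal] by blast
    have "b > 0"
    proof (rule ccontr)
      assume "\<not> b > 0"
      then have "card (rcosets ?Z) = 1" using b by (simp add: order_def FactGroup_def)
      then have "card ?Z = order G"
        using lagrange[OF normal_imp_subgroup[OF upper_central_normal[of n]]] by simp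
      then show False using neg sub[of n] assms(2) by (metis card_subset_eq order_def)
    qed
    then obtain U where U: "U \<in> center (G Mod ?Z)" "U \<noteq> \<one>\<^bsub>G Mod ?Z\<^esub>"
      using Q.center_nontrivial[OF assms(1) b] by blast
    then obtain x where x: "x \<in> carrier G" "U = ?Z #> x" using center_carrier mem_carrier_Mod by metis
    have "x \<in> upper_central G (Suc n)" "x \<notin> ?Z"
      using x U coset_eq_one_iff[OF upper_central_normal] by auto
    moreover have "?Z \<subseteq> upper_central G (Suc n)"
    proof
      fix z assume z: "z \<in> ?Z"
      have "z \<otimes> g \<otimes> inv (g \<otimes> z) \<in> ?Z" if "g \<in> carrier G" for g
      proof -
        have "g \<otimes> inv z \<otimes> inv g \<in> ?Z"
          using that z upper_central_normal subgroup.m_inv_closed normal_imp_subgroup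
          by (metis normal_inv_iff)
        moreover have "z \<otimes> g \<otimes> inv (g \<otimes> z) = z \<otimes> (g \<otimes> inv z \<otimes> inv g)"
          using that z sub by (simp add: subset_iff inv_mult_group m_assoc)
        ultimately show ?thesis
          using z subgroup.m_closed normal_imp_subgroup upper_central_normal by metis
      qed
      then show "z \<in> upper_central G (Suc n)" using z sub mem_upper_central_Suc by blast
    qed
    ultimately have "?Z \<subset> upper_central G (Suc n)" by blast
    then have "card ?Z < card (upper_central G (Suc n))"
      using sub assms(2) by (meson psubset_card_mono finite_subset)
    then show ?case using Suc by linarith
  qed simp
  have "card (upper_central G (Suc (order G))) \<le> order G"
    using sub assms(2) unfolding order_def by (rule card_mono[rotated])
  then show False using grow[of "Suc (order G)"] by linarith
qed

section \<open>Groups whose elements of order p, or of order dividing 4, are central\<close>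

definition bold_p_central :: "nat \<Rightarrow> ('a, 'b) monoid_scheme \<Rightarrow> bool" where
  "bold_p_central p G \<longleftrightarrow>
     (\<forall>x \<in> carrier G. x [^]\<^bsub>G\<^esub> bold_p p = \<one>\<^bsub>G\<^esub> \<longrightarrow> x \<in> center G)"

lemma (in group) swap_commutator:
  assumes "x \<in> carrier G" "y \<in> carrier G"
  shows "y \<otimes> x = y \<otimes> x \<otimes> inv (x \<otimes> y) \<otimes> (x \<otimes> y)"
  using assms m_assoc[of "y \<otimes> x" "inv (x \<otimes> y)" "x \<otimes> y"] by (simp del: inv_mult_group)

locale bold_p_central_group = group +
  fixes p :: nat
  assumes prime: "Factorial_Ring.prime p" and central: "bold_p_central p G"

context bold_p_central_group
begin

lemma central_if_bold_pow: "x \<in> carrier G \<Longrightarrow> x [^] bold_p p = \<one> \<Longrightarrow> x \<in> center G"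
  using central by (simp add: bold_p_central_def)

lemma central_if_pow: "x \<in> carrier G \<Longrightarrow> x [^] p = \<one> \<Longrightarrow> x \<in> center G"
proof (rule central_if_bold_pow)
  assume x: "x \<in> carrier G" "x [^] p = \<one>"
  then have "x [^] (p * k) = \<one>" for k by (simp add: nat_pow_pow[symmetric])
  moreover have "p dvd bold_p p" by (simp add: bold_p_def)
  ultimately show "x [^] bold_p p = \<one>" by (auto elim: dvdE)
qed

lemma choose_2_pow_trivial:
  assumes "p \<noteq> 2" "c \<in> carrier G" "c [^] p = \<one>"
  shows "c [^] (p choose 2) = \<one>"
proof -
  have "p > 2" using assms(1) prime prime_ge_2_nat[of p] by linarith
  then have "p dvd (p choose 2)" using prime by (intro dvd_choose_prime) auto
  then show ?thesis using assms by (auto simp: nat_pow_pow[symmetric] elim!: dvdE)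
qed

text \<open>With \<open>d = [y, x]\<close> central of order dividing \<open>p\<close>, the collection formula gives
  \<open>(y \<otimes> inv x) [^] p = d [^] (p choose 2)\<close>. For odd \<open>p\<close> the exponent is a multiple of \<open>p\<close>. For
  \<open>p = 2\<close> the right-hand side is \<open>d\<close> itself, so that \<open>y \<otimes> inv x\<close> has order dividing 4 and is therefore
  central; then \<open>x\<close> and \<open>y\<close> commute. This is the reason for taking 4 instead of 2.\<close>

lemma commutator_pow:
  assumes x: "x \<in> carrier G" and y: "y \<in> carrier G" and eq: "x [^] p = y [^] p"
    and c: "(y \<otimes> x \<otimes> inv (x \<otimes> y)) [^] p = \<one>"
  shows "(y \<otimes> inv x) [^] p = \<one>"
proof -
  define w where "w = inv x"
  define d where "d = y \<otimes> x \<otimes> inv (x \<otimes> y)"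
  have dc: "d \<in> center G" using c x y central_if_pow by (simp add: d_def)
  have dG: "d \<in> carrier G" using dc by (rule center_carrier)
  have wG: "w \<in> carrier G" using x w_def by simp
  have "y \<otimes> x = d \<otimes> (x \<otimes> y)" using x y swap_commutator by (simp add: d_def)
  then have "w \<otimes> (y \<otimes> x) \<otimes> w = d \<otimes> (w \<otimes> (x \<otimes> y)) \<otimes> w"
    using center_commute[OF dc wG] x y wG dG by (metis m_assoc m_closed)
  moreover have "w \<otimes> (y \<otimes> x) \<otimes> w = w \<otimes> y" using x y by (simp add: w_def m_assoc)
  moreover have "w \<otimes> (x \<otimes> y) = y" using x y by (simp add: w_def m_assoc[symmetric])
  ultimately have swap: "w \<otimes> y = d \<otimes> (y \<otimes> w)" using y wG dG by (simp add: m_assoc)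
  have wp: "w [^] p = inv (x [^] p)" using x by (simp add: w_def nat_pow_inv)
  have pow: "(y \<otimes> w) [^] p = d [^] (p choose 2)"
    using mult_pow_central_commutator[OF y wG dc swap, of p] wp eq y wG dG by simp
  show ?thesis
  proof (cases "p = 2")
    case False
    then show ?thesis using pow choose_2_pow_trivial[of d] dG c by (simp add: d_def w_def)
  next
    case True
    then have "(y \<otimes> w) [^] (2 :: nat) = d" using pow dG by simp
    then have "(y \<otimes> w) [^] bold_p p = d [^] (2 :: nat)"
      using y wG nat_pow_pow[of "y \<otimes> w" 2 2] True by (simp add: bold_p_def)
    then have yw: "y \<otimes> w \<in> center G"
      using c True y wG by (intro central_if_bold_pow) (auto simp: d_def)
    have "y = (y \<otimes> w) \<otimes> x" using x y by (simp add: w_def m_assoc)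
    then have "y [^] p = (y \<otimes> w) [^] p \<otimes> x [^] p"
      using pow_mult_distrib[of "y \<otimes> w" x p] center_commute[OF yw x] y wG x by (metis m_closed)
    then show ?thesis using eq y wG x by (metis l_cancel_one m_closed nat_pow_closed w_def r_cancel_one')
  qed
qed

text \<open>If \<open>x\<close> and \<open>y\<close> have the same \<open>p\<close>-th power, so have \<open>x\<close> and its conjugate by \<open>y\<close>, and the quotient
  of these two is the commutator \<open>[y, x] = [y \<otimes> inv x, x]\<close>, which lies one step lower in the upper
  central series than \<open>y \<otimes> inv x\<close>. So induction along this series provides the hypothesis of
  \<open>commutator_pow\<close>.\<close>

lemma pow_eq_imp_quotient_pow:
  assumes nil: "upper_central G n = carrier G"
    and "x \<in> carrier G" "y \<in> carrier G" "x [^] p = y [^] p"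
  shows "(y \<otimes> inv x) [^] p = \<one>"
proof -
  have "x \<in> carrier G \<Longrightarrow> y \<in> carrier G \<Longrightarrow> x [^] p = y [^] p
      \<Longrightarrow> y \<otimes> inv x \<in> upper_central G i \<Longrightarrow> (y \<otimes> inv x) [^] p = \<one>" for i y
  proof (induction i arbitrary: y)
    case 0
    then show ?case by simp
  next
    case (Suc i)
    let ?y = "y \<otimes> x \<otimes> inv y"
    have yG: "?y \<in> carrier G" using Suc.prems by simp
    have "?y [^] p = y \<otimes> x [^] p \<otimes> inv y"
      using Suc.prems(1,2) by (intro pow_conj)
    also have "\<dots> = x [^] p"
      using Suc.prems(1-3) by (metis inv_solve_right' m_closed nat_pow_Suc nat_pow_Suc2 nat_pow_closed)
    finally have eq: "x [^] p = ?y [^] p" by simp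
    define d where "d = y \<otimes> inv x"
    have d: "d \<in> upper_central G (Suc i)" using Suc.prems d_def by simp
    then have "d \<otimes> x \<otimes> inv (x \<otimes> d) \<in> upper_central G i"
      using mem_upper_central_Suc Suc.prems(1) by blast
    moreover have "d \<otimes> x \<otimes> inv (x \<otimes> d) = ?y \<otimes> inv x"
      using Suc.prems(1,2) by (simp add: d_def inv_mult_group m_assoc)
    ultimately have "(?y \<otimes> inv x) [^] p = \<one>"
      using Suc.IH[OF Suc.prems(1) yG eq] by simp
    moreover have "?y \<otimes> inv x = y \<otimes> x \<otimes> inv (x \<otimes> y)"
      using Suc.prems(1,2) by (simp add: inv_mult_group m_assoc)
    ultimately show ?case using commutator_pow Suc.prems by simp
  qed
  from this[of y n] show ?thesis using assms by simp
qed

text \<open>The power \<open>x [^] p\<close> is central, so \<open>x\<close> and each of its conjugates have the same \<open>p\<close>-th power.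
  The lemma says that modulo the elements of order dividing \<open>p\<close> the group satisfies
  \<open>bold_p_central\<close> again; this is what makes an induction possible.\<close>

lemma commutator_pow_trivial:
  assumes nil: "upper_central G n = carrier G"
    and x: "x \<in> carrier G" "g \<in> carrier G" "x [^] (p * bold_p p) = \<one>"
  shows "(g \<otimes> x \<otimes> inv (x \<otimes> g)) [^] p = \<one>"
proof -
  have "x [^] p \<in> center G"
    using x by (intro central_if_bold_pow) (auto simp: nat_pow_pow)
  then have "g \<otimes> x [^] p \<otimes> inv g = x [^] p"
    using x center_commute by (metis inv_solve_right' m_closed nat_pow_closed)
  then have "(g \<otimes> x \<otimes> inv g) [^] p = x [^] p"
    using x pow_conj by simp
  then have "(g \<otimes> x \<otimes> inv g \<otimes> inv x) [^] p = \<one>"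
    using x by (intro pow_eq_imp_quotient_pow[OF nil]) auto
  then show ?thesis using x by (simp add: inv_mult_group m_assoc)
qed

text \<open>For \<open>p = 2\<close> the element \<open>x\<close> is itself central. For odd \<open>p\<close> the commutator of \<open>y\<close> and \<open>x\<close> is
  central of order dividing \<open>p\<close>, so its contribution \<open>c [^] (p choose 2)\<close> in the collection formula
  vanishes.\<close>

lemma pow_mult_of_square_exponent:
  assumes nil: "upper_central G n = carrier G"
    and x: "x \<in> carrier G" "y \<in> carrier G" "x [^] (p * p) = \<one>" "y [^] (p * p) = \<one>"
  shows "(x \<otimes> y) [^] p = x [^] p \<otimes> y [^] p"
proof (cases "p = 2")
  case True
  then have "x \<in> center G" using x by (intro central_if_bold_pow) (auto simp: bold_p_def)
  then show ?thesis using pow_mult_distrib x center_commute by metis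
next
  case False
  define c where "c = y \<otimes> x \<otimes> inv (x \<otimes> y)"
  have cG: "c \<in> carrier G" using x by (simp add: c_def)
  have cp: "c [^] p = \<one>" unfolding c_def
    using False x by (intro commutator_pow_trivial[OF nil]) (auto simp: bold_p_def)
  then have cc: "c \<in> center G" using central_if_pow cG by blast
  have "y \<otimes> x = c \<otimes> (x \<otimes> y)" using x swap_commutator by (simp add: c_def)
  then show ?thesis
    using mult_pow_central_commutator[OF x(1,2) cc, of p] choose_2_pow_trivial[OF False cG cp] x by simp
qed

end

context bold_p_central_group
begin

section \<open>Powers as homomorphisms on p-groups\<close>

lemma subgroup_omega: "subgroup {x \<in> carrier G. x [^] p = \<one>} G"
proof (rule subgroupI)
  fix x y assume "x \<in> {x \<in> carrier G. x [^] p = \<one>}" "y \<in> {x \<in> carrier G. x [^] p = \<one>}"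
  then have xy: "x \<in> carrier G" "y \<in> carrier G" "x [^] p = \<one>" "y [^] p = \<one>" by auto
  then show "x \<otimes> y \<in> {x \<in> carrier G. x [^] p = \<one>}"
    using pow_mult_distrib[of x y p] center_commute[OF central_if_pow] by simp
qed (auto simp: nat_pow_inv)

lemma omega_normal: "{x \<in> carrier G. x [^] p = \<one>} \<lhd> G"
  using subgroup_omega by (auto simp: normal_inv_iff pow_conj)

end

text \<open>This set is the preimage in \<open>G\<close> of the subgroup of elements of order dividing \<open>p\<close> of \<open>G Mod N\<close>.
  The induction below runs over normal subgroups \<open>N\<close> of one fixed group, because iterated quotient
  groups would have ever larger types.\<close>

lemma (in group) pow_preimage_normal:
  assumes N: "N \<lhd> G" and prime: "Factorial_Ring.prime p" and central: "bold_p_central p (G Mod N)"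
  shows "{x \<in> carrier G. x [^] p \<in> N} \<lhd> G"
proof -
  interpret q: group_hom G "G Mod N" "\<lambda>x. N #> x" using N by (rule coset_group_hom)
  interpret Q: bold_p_central_group "G Mod N" p
    using prime central by (simp add: bold_p_central_group_def bold_p_central_group_axioms_def)
  let ?\<Omega> = "{U \<in> carrier (G Mod N). U [^]\<^bsub>G Mod N\<^esub> p = \<one>\<^bsub>G Mod N\<^esub>}"
  have mem: "x \<in> {x \<in> carrier G. x [^] p \<in> N} \<longleftrightarrow> x \<in> carrier G \<and> N #> x \<in> ?\<Omega>" for x
    using coset_eq_one_iff[OF N, of "x [^] p"] q.hom_nat_pow[of x p] q.hom_closed[of x] by auto
  note \<Omega> = Q.omega_normal[unfolded q.H.normal_inv_iff]
  have sub: "subgroup ?\<Omega> (G Mod N)" using \<Omega> by blast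
  show ?thesis
    unfolding normal_inv_iff
  proof (intro conjI ballI subgroupI)
    show "{x \<in> carrier G. x [^] p \<in> N} \<subseteq> carrier G" by blast
    have "\<one> \<in> {x \<in> carrier G. x [^] p \<in> N}"
      using subgroup.one_closed[OF normal_imp_subgroup[OF N]] by simp
    then show "{x \<in> carrier G. x [^] p \<in> N} \<noteq> {}" by blast
  next
    fix a b assume "a \<in> {x \<in> carrier G. x [^] p \<in> N}" "b \<in> {x \<in> carrier G. x [^] p \<in> N}"
    then have ab: "a \<in> carrier G" "b \<in> carrier G" "N #> a \<in> ?\<Omega>" "N #> b \<in> ?\<Omega>" using mem by blast+
    have "N #> (a \<otimes> b) \<in> ?\<Omega>"
      unfolding q.hom_mult[OF ab(1,2)] by (rule subgroup.m_closed[OF sub ab(3,4)])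
    then show "a \<otimes> b \<in> {x \<in> carrier G. x [^] p \<in> N}" using mem ab(1,2) by blast
  next
    fix a assume "a \<in> {x \<in> carrier G. x [^] p \<in> N}"
    then have a: "a \<in> carrier G" "N #> a \<in> ?\<Omega>" using mem by blast+
    have "N #> inv a \<in> ?\<Omega>"
      unfolding q.hom_inv[OF a(1)] by (rule subgroup.m_inv_closed[OF sub a(2)])
    then show "inv a \<in> {x \<in> carrier G. x [^] p \<in> N}" using mem a(1) by blast
  next
    fix g a assume g: "g \<in> carrier G" and a: "a \<in> {x \<in> carrier G. x [^] p \<in> N}"
    then have aG: "a \<in> carrier G" and "N #> a \<in> ?\<Omega>" using mem by blast+
    then have "(N #> g) \<otimes>\<^bsub>G Mod N\<^esub> (N #> a) \<otimes>\<^bsub>G Mod N\<^esub> inv\<^bsub>G Mod N\<^esub> (N #> g) \<in> ?\<Omega>"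
      using \<Omega> q.hom_closed[OF g] by blast
    then have "N #> (g \<otimes> a \<otimes> inv g) \<in> ?\<Omega>"
      using g aG by (simp only: q.hom_mult q.hom_inv m_closed inv_closed)
    then show "g \<otimes> a \<otimes> inv g \<in> {x \<in> carrier G. x [^] p \<in> N}" using mem g aG by blast
  qed
qed

locale finite_p_group = group +
  fixes p a :: nat
  assumes prime: "Factorial_Ring.prime p" and fin: "finite (carrier G)" and order: "order G = p ^ a"

context finite_p_group
begin

lemma quotient_nilpotent:
  assumes "N \<lhd> G"
  shows "\<exists>n. upper_central (G Mod N) n = carrier (G Mod N)"
  using group.p_group_nilpotent[OF normal.factorgroup_is_group[OF assms] prime]
    p_group_quotient[OF prime fin order assms] by blast

text \<open>An element whose \<open>bold_p p\<close>-th power has its \<open>p\<close>-th power in \<open>N\<close> is a case of \<open>commutator_pow_trivial\<close> in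
  \<open>G Mod N\<close>, which puts its commutators into the preimage.\<close>

lemma bold_p_central_pow_preimage:
  assumes N: "N \<lhd> G" and central: "bold_p_central p (G Mod N)"
  shows "bold_p_central p (G Mod {x \<in> carrier G. x [^] p \<in> N})"
proof -
  define M where "M = {x \<in> carrier G. x [^] p \<in> N}"
  have M: "M \<lhd> G" unfolding M_def using pow_preimage_normal[OF N prime central] .
  interpret q: group_hom G "G Mod N" "\<lambda>x. N #> x" using N by (rule coset_group_hom)
  interpret r: group_hom G "G Mod M" "\<lambda>x. M #> x" using M by (rule coset_group_hom)
  interpret Q: bold_p_central_group "G Mod N" p
    using prime central by (simp add: bold_p_central_group_def bold_p_central_group_axioms_def)
  obtain n where nil: "upper_central (G Mod N) n = carrier (G Mod N)"
    using quotient_nilpotent[OF N] by blast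
  have "U \<in> center (G Mod M)"
    if U: "U \<in> carrier (G Mod M)" "U [^]\<^bsub>G Mod M\<^esub> bold_p p = \<one>\<^bsub>G Mod M\<^esub>" for U
  proof -
    obtain x where x: "x \<in> carrier G" "U = M #> x" using U(1) mem_carrier_Mod by blast
    have "x [^] bold_p p \<in> M"
      using U x coset_eq_one_iff[OF M, of "x [^] bold_p p"] r.hom_nat_pow by simp
    then have "x [^] (p * bold_p p) \<in> N" using x by (simp add: M_def nat_pow_pow mult.commute)
    then have xN: "(N #> x) [^]\<^bsub>G Mod N\<^esub> (p * bold_p p) = \<one>\<^bsub>G Mod N\<^esub>"
      using coset_eq_one_iff[OF N, of "x [^] (p * bold_p p)"] x q.hom_nat_pow by simp
    have "M #> (x \<otimes> g) = M #> (g \<otimes> x)" if g: "g \<in> carrier G" for g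
    proof -
      have "N #> ((g \<otimes> x \<otimes> inv (x \<otimes> g)) [^] p) = \<one>\<^bsub>G Mod N\<^esub>"
        using Q.commutator_pow_trivial[OF nil q.hom_closed[OF x(1)] q.hom_closed[OF g] xN]
          x g q.hom_nat_pow by (simp del: inv_mult_group)
      then have "g \<otimes> x \<otimes> inv (x \<otimes> g) \<in> M"
        unfolding M_def using x g coset_eq_one_iff[OF N, of "(g \<otimes> x \<otimes> inv (x \<otimes> g)) [^] p"]
        by (simp del: inv_mult_group)
      then show ?thesis using coset_eq_iff[OF normal_imp_subgroup[OF M], of "g \<otimes> x" "x \<otimes> g"] x g
        by (simp del: inv_mult_group)
    qed
    then show ?thesis using preimage_center_iff[OF M x(1)] x by blast
  qed
  then show ?thesis unfolding bold_p_central_def M_def by blast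
qed

text \<open>Pass from \<open>N\<close> to \<open>M\<close>, the elements whose \<open>p\<close>-th power is in \<open>N\<close>. By induction
  \<open>(x \<otimes> y) [^] (p ^ i) = t \<otimes> (u \<otimes> v)\<close> with \<open>t \<in> M\<close>, where \<open>u\<close> and \<open>v\<close> are the powers of \<open>x\<close> and \<open>y\<close>.
  Modulo \<open>N\<close>, \<open>t\<close> is central with trivial \<open>p\<close>-th power, and \<open>u\<close>, \<open>v\<close> have order dividing \<open>p * p\<close>, so
  the \<open>p\<close>-th power of the right-hand side is \<open>u [^] p \<otimes> v [^] p\<close>.\<close>

lemma pow_mult_mod:
  assumes "N \<lhd> G" "bold_p_central p (G Mod N)" "x \<in> carrier G" "y \<in> carrier G"
    "x [^] (p ^ Suc i) \<in> N" "y [^] (p ^ Suc i) \<in> N"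
  shows "N #> ((x \<otimes> y) [^] (p ^ i)) = N #> (x [^] (p ^ i) \<otimes> y [^] (p ^ i))"
  using assms
proof (induction i arbitrary: N)
  case 0
  show ?case using 0(3,4) by simp
next
  case (Suc i)
  note N = Suc.prems(1) and xy = Suc.prems(3,4)
  define M where "M = {x \<in> carrier G. x [^] p \<in> N}"
  have M: "M \<lhd> G" unfolding M_def using pow_preimage_normal[OF N prime Suc.prems(2)] .
  have Mc: "bold_p_central p (G Mod M)"
    unfolding M_def using bold_p_central_pow_preimage[OF N Suc.prems(2)] .
  interpret q: group_hom G "G Mod N" "\<lambda>x. N #> x" using N by (rule coset_group_hom)
  interpret Q: bold_p_central_group "G Mod N" p
    using prime Suc.prems(2) by (simp add: bold_p_central_group_def bold_p_central_group_axioms_def)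
  obtain n where nil: "upper_central (G Mod N) n = carrier (G Mod N)"
    using quotient_nilpotent[OF N] by blast
  define u v where "u = x [^] (p ^ i)" and "v = y [^] (p ^ i)"
  have uv: "u \<in> carrier G" "v \<in> carrier G" using xy by (auto simp: u_def v_def)
  have "x [^] (p ^ Suc i) \<in> M" "y [^] (p ^ Suc i) \<in> M"
    using Suc.prems by (auto simp: M_def nat_pow_pow mult_ac)
  then have "M #> ((x \<otimes> y) [^] (p ^ i)) = M #> (u \<otimes> v)"
    unfolding u_def v_def using Suc.IH[OF M Mc xy] by blast
  then have tM: "(x \<otimes> y) [^] (p ^ i) \<otimes> inv (u \<otimes> v) \<in> M"
    using coset_eq_iff[OF normal_imp_subgroup[OF M]] xy uv by simp
  define t where "t = (x \<otimes> y) [^] (p ^ i) \<otimes> inv (u \<otimes> v)"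
  have tG: "t \<in> carrier G" using xy uv by (simp add: t_def)
  have eq: "(x \<otimes> y) [^] (p ^ i) = t \<otimes> (u \<otimes> v)"
    using xy uv m_assoc[of "(x \<otimes> y) [^] (p ^ i)" "inv (u \<otimes> v)" "u \<otimes> v"] by (simp add: t_def del: inv_mult_group)
  have tp: "(N #> t) [^]\<^bsub>G Mod N\<^esub> p = \<one>\<^bsub>G Mod N\<^esub>"
    using tM tG coset_eq_one_iff[OF N, of "t [^] p"] q.hom_nat_pow by (simp add: t_def[symmetric] M_def)
  have tc: "N #> t \<in> center (G Mod N)" using Q.central_if_pow tp q.hom_closed[OF tG] by blast
  have uvQ: "N #> (u \<otimes> v) \<in> carrier (G Mod N)" using uv by (intro q.hom_closed) simp
  have pp: "(N #> z) [^]\<^bsub>G Mod N\<^esub> (p * p) = \<one>\<^bsub>G Mod N\<^esub>"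
    if "z = w [^] (p ^ i)" "w [^] (p ^ Suc (Suc i)) \<in> N" "w \<in> carrier G" for z w
    using that coset_eq_one_iff[OF N, of "z [^] (p * p)"] q.hom_nat_pow[of z "p * p"]
    by (simp add: nat_pow_pow mult_ac)
  have "N #> ((x \<otimes> y) [^] (p ^ Suc i)) = N #> ((t \<otimes> (u \<otimes> v)) [^] p)"
    using xy eq[symmetric] by (simp add: nat_pow_pow mult.commute)
  also have "\<dots> = ((N #> t) \<otimes>\<^bsub>G Mod N\<^esub> (N #> (u \<otimes> v))) [^]\<^bsub>G Mod N\<^esub> p"
    using tG uv by (simp only: q.hom_nat_pow q.hom_mult m_closed)
  also have "\<dots> = (N #> (u \<otimes> v)) [^]\<^bsub>G Mod N\<^esub> p"
  proof -
    have "((N #> t) \<otimes>\<^bsub>G Mod N\<^esub> (N #> (u \<otimes> v))) [^]\<^bsub>G Mod N\<^esub> p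
        = (N #> t) [^]\<^bsub>G Mod N\<^esub> p \<otimes>\<^bsub>G Mod N\<^esub> (N #> (u \<otimes> v)) [^]\<^bsub>G Mod N\<^esub> p"
      by (rule q.H.pow_mult_distrib[OF center_commute[OF tc uvQ] q.hom_closed[OF tG] uvQ])
    also have "\<dots> = (N #> (u \<otimes> v)) [^]\<^bsub>G Mod N\<^esub> p"
      unfolding tp by (rule q.H.l_one[OF q.H.nat_pow_closed[OF uvQ]])
    finally show ?thesis .
  qed
  also have "\<dots> = (N #> u) [^]\<^bsub>G Mod N\<^esub> p \<otimes>\<^bsub>G Mod N\<^esub> (N #> v) [^]\<^bsub>G Mod N\<^esub> p"
    using Q.pow_mult_of_square_exponent[OF nil q.hom_closed[OF uv(1)] q.hom_closed[OF uv(2)]]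
      pp[OF u_def Suc.prems(5) xy(1)] pp[OF v_def Suc.prems(6) xy(2)] uv by (simp only: q.hom_mult)
  also have "\<dots> = N #> (u [^] p \<otimes> v [^] p)"
    using uv by (simp only: q.hom_nat_pow q.hom_mult nat_pow_closed)
  finally show ?case using xy by (simp add: u_def v_def nat_pow_pow mult.commute)
qed

lemma pow_mult_distrib_if_bold_p_central:
  assumes c: "bold_p_central p G" and "x \<in> carrier G" "y \<in> carrier G"
    and "x [^] (p ^ Suc i) = \<one>" "y [^] (p ^ Suc i) = \<one>"
  shows "(x \<otimes> y) [^] (p ^ i) = x [^] (p ^ i) \<otimes> y [^] (p ^ i)"
proof -
  have N: "{\<one>} \<lhd> G" by (rule one_is_normal)
  interpret q: group_hom G "G Mod {\<one>}" "\<lambda>x. {\<one>} #> x" using N by (rule coset_group_hom)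
  have single: "{\<one>} #> x = {x}" if "x \<in> carrier G" for x
    using that by (simp add: r_coset_def)
  have "bold_p_central p (G Mod {\<one>})"
    unfolding bold_p_central_def
  proof (intro ballI impI)
    fix U assume U: "U \<in> carrier (G Mod {\<one>})" "U [^]\<^bsub>G Mod {\<one>}\<^esub> bold_p p = \<one>\<^bsub>G Mod {\<one>}\<^esub>"
    then obtain z where z: "z \<in> carrier G" "U = {\<one>} #> z" using mem_carrier_Mod by blast
    then have "z [^] bold_p p = \<one>"
      using U coset_eq_one_iff[OF N, of "z [^] bold_p p"] q.hom_nat_pow[of z "bold_p p"] by auto
    then have "z \<in> center G" using c z by (simp add: bold_p_central_def)
    then show "U \<in> center (G Mod {\<one>})"
      using preimage_center_iff[OF N z(1)] z center_commute[of z G] by simp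
  qed
  from pow_mult_mod[OF N this assms(2,3)] show ?thesis using assms single by simp
qed

end

section \<open>The transfer\<close>

text \<open>A product over the points moved by a permutation \<open>s\<close> splits into the products over its cycles.\<close>

lemma (in comm_monoid) finprod_eq_power_of_cycles:
  assumes "finite T" "bij_betw s T T" "f \<in> T \<rightarrow> carrier G" "c \<in> carrier G"
    and "\<And>t k. t \<in> T \<Longrightarrow> (s ^^ k) t = t \<Longrightarrow> finprod G (\<lambda>i. f ((s ^^ i) t)) {..<k} = c [^] k"
  shows "finprod G f T = c [^] card T"
  using assms
proof (induction T rule: finite_psubset_induct)
  case (psubset T)
  show ?case
  proof (cases "T = {}")
    case True
    then show ?thesis by simp
  next
    case False
    then obtain t where t: "t \<in> T" by blast
    have inj: "inj_on s T" and im: "s ` T = T"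
      using psubset.prems(1) by (auto simp: bij_betw_def)
    have mem: "(s ^^ i) t \<in> T" for i
      using t im by (induction i) auto
    define R where "R = (\<lambda>j. \<exists>i<j. (s ^^ i) t = (s ^^ j) t)"
    have "\<not> inj_on (\<lambda>i. (s ^^ i) t) (UNIV :: nat set)"
      using mem psubset.hyps(1) by (metis finite_subset finite_imageD image_subsetI infinite_UNIV_nat)
    then obtain i j where "i \<noteq> j" "(s ^^ i) t = (s ^^ j) t" by (auto simp: inj_on_def)
    then have "\<exists>j. R j" unfolding R_def by (metis linorder_neqE_nat)
    \<comment> \<open>the length of the cycle through \<open>t\<close>; the first value to recur is \<open>t\<close> itself since \<open>s\<close> is injective\<close>
    define k where "k = (LEAST j. R j)"
    have Rk: "R k" using \<open>\<exists>j. R j\<close> unfolding k_def by (rule LeastI_ex)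
    have min: "\<not> R j" if "j < k" for j using that not_less_Least unfolding k_def by blast
    obtain i where i: "i < k" "(s ^^ i) t = (s ^^ k) t" using Rk R_def by blast
    have "i = 0"
    proof (rule ccontr)
      assume "i \<noteq> 0"
      then obtain i' k' where ik: "i = Suc i'" "k = Suc k'" using i(1) by (metis Suc_lessE not0_implies_Suc)
      then have "(s ^^ i') t = (s ^^ k') t" using i(2) mem inj by (auto simp: inj_on_def)
      then show False using min[of k'] ik i(1) R_def by auto
    qed
    then have k: "(s ^^ k) t = t" "0 < k" using i by auto
    define U where "U = (\<lambda>i. (s ^^ i) t) ` {..<k}"
    have injU: "inj_on (\<lambda>i. (s ^^ i) t) {..<k}"
      unfolding inj_on_def
    proof (intro ballI impI)
      fix a b assume "a \<in> {..<k}" "b \<in> {..<k}" "(s ^^ a) t = (s ^^ b) t"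
      then show "a = b" using min R_def by (metis lessThan_iff linorder_neqE_nat)
    qed
    have cardU: "card U = k" unfolding U_def using injU by (simp add: card_image)
    have UT: "U \<subseteq> T" using mem U_def by blast
    have tU: "t \<in> U" unfolding U_def using k by (auto intro!: image_eqI[of _ _ 0])
    have "s ` U \<subseteq> U"
    proof
      fix u assume "u \<in> s ` U"
      then obtain i where "i < k" "u = (s ^^ Suc i) t" by (auto simp: U_def)
      then show "u \<in> U" using k tU unfolding U_def
        by (cases "Suc i = k") (auto intro!: image_eqI[of _ _ "Suc i"])
    qed
    moreover have finU: "finite U" using U_def by simp
    ultimately have sU: "s ` U = U"
      using inj UT by (meson endo_inj_surj inj_on_subset)
    have "s ` (T - U) = T - U"
      using inj UT im sU by (metis Diff_subset inj_on_image_set_diff)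
    then have bij: "bij_betw s (T - U) (T - U)"
      using inj by (auto simp: bij_betw_def intro: inj_on_subset)
    have "finprod G f T = finprod G f (U \<union> (T - U))" using UT by (simp add: Un_absorb1)
    also have "\<dots> = finprod G f U \<otimes> finprod G f (T - U)"
      using psubset.prems(2) psubset.hyps(1) finU UT by (intro finprod_Un_disjoint) auto
    also have "finprod G f U = finprod G (\<lambda>i. f ((s ^^ i) t)) {..<k}"
      unfolding U_def using psubset.prems(2) mem injU by (intro finprod_reindex) auto
    also have "\<dots> = c [^] k" using psubset.prems(4)[OF t k(1)] .
    also have "finprod G f (T - U) = c [^] card (T - U)"
      using psubset.prems UT tU bij by (intro psubset.IH) auto
    also have "c [^] k \<otimes> c [^] card (T - U) = c [^] (k + card (T - U))"
      using psubset.prems(3) by (simp add: nat_pow_mult)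
    also have "k + card (T - U) = card T"
      using cardU UT psubset.hyps(1) finU by (metis card_Diff_subset card_mono le_add_diff_inverse)
    finally show ?thesis .
  qed
qed

lemma (in group) subgroup_nat_pow_closed:
  assumes "subgroup H G" "x \<in> H"
  shows "x [^] (n :: nat) \<in> H"
  using assms by (induction n) (auto simp: subgroup.one_closed subgroup.m_closed)

text \<open>The transfer of \<open>\<phi>\<close>: fix a representative \<open>r C\<close> of every right coset \<open>C\<close> of \<open>P\<close> and multiply the values of
  \<open>\<phi>\<close> at \<open>r C \<otimes> g \<otimes> inv (r (C #> g))\<close>. Along a cycle of length \<open>k\<close> of \<open>x\<close> on the cosets these arguments
  telescope to a conjugate of \<open>x [^] k\<close>, at which \<open>\<phi>\<close> has the value \<open>\<phi> x [^] k\<close> if it respects conjugacy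
  in \<open>G\<close>.\<close>

lemma (in group) transfer:
  assumes P: "subgroup P G" and fin: "finite (carrier G)" and A: "comm_group A"
    and hom: "\<phi> \<in> hom (G\<lparr>carrier := P\<rparr>) A"
    and stable: "\<And>x g. x \<in> P \<Longrightarrow> g \<in> carrier G \<Longrightarrow> g \<otimes> x \<otimes> inv g \<in> P \<Longrightarrow> \<phi> (g \<otimes> x \<otimes> inv g) = \<phi> x"
  shows "\<exists>V \<in> hom G A. \<forall>x \<in> P. V x = \<phi> x [^]\<^bsub>A\<^esub> card (rcosets P)"
proof -
  interpret A: comm_group A by fact
  interpret P: subgroup P G by fact
  define T where "T = rcosets P"
  have PG: "P \<subseteq> carrier G" using P.subset .
  have finT: "finite T"
    unfolding T_def using fin by (simp add: RCOSETS_def)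
  define r :: "'a set \<Rightarrow> 'a" where "r = (\<lambda>C. SOME x. x \<in> C)"
  have r: "r C \<in> C" if "C \<in> T" for C
    unfolding r_def using that P.rcosets_non_empty some_in_eq T_def by metis
  have rG: "r C \<in> carrier G" if "C \<in> T" for C
    using r[OF that] that P.rcosets_carrier[OF is_group] T_def by blast
  have rC: "P #> r C = C" if "C \<in> T" for C
    using that r[OF that] P repr_independence unfolding T_def RCOSETS_def by blast
  have act: "C #> g \<in> T" if "C \<in> T" "g \<in> carrier G" for C g
  proof -
    have "C #> g = P #> (r C \<otimes> g)" using rC[OF that(1)] rG[OF that(1)] that(2) coset_mult_assoc PG by metis
    then show ?thesis using rG that PG rcosetsI T_def by simp
  qed
  have TG: "C \<subseteq> carrier G" if "C \<in> T" for C
    using that P.rcosets_carrier[OF is_group] T_def by blast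
  have actact: "C #> g #> h = C #> (g \<otimes> h)" if "C \<in> T" "g \<in> carrier G" "h \<in> carrier G" for C g h
    using that TG coset_mult_assoc by blast
  have bij: "bij_betw (\<lambda>C. C #> g) T T" if g: "g \<in> carrier G" for g
    by (rule bij_betw_byWitness[where f' = "\<lambda>C. C #> inv g"])
       (use g act actact TG in \<open>auto simp: coset_mult_one\<close>)
  define d where "d = (\<lambda>g C. r C \<otimes> g \<otimes> inv (r (C #> g)))"
  have dP: "d g C \<in> P" if "C \<in> T" "g \<in> carrier G" for g C
  proof -
    have "P #> (r C \<otimes> g) = C #> g" using rC[OF that(1)] rG[OF that(1)] that(2) coset_mult_assoc PG by metis
    also have "\<dots> = P #> r (C #> g)" using rC act that by simp
    finally have "r C \<otimes> g \<in> P #> r (C #> g)"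
      using rG that P rcos_self by (metis m_closed)
    then show ?thesis unfolding d_def
      using P.rcos_module_imp[OF is_group] rG act that by simp
  qed
  have dmult: "d (g \<otimes> h) C = d g C \<otimes> d h (C #> g)"
    if "C \<in> T" "g \<in> carrier G" "h \<in> carrier G" for g h C
    unfolding d_def using that rG act actact by (simp add: m_assoc inv_solve_left)
  have \<phi>A: "\<phi> x \<in> carrier A" if "x \<in> P" for x
    using hom that by (auto simp: hom_def)
  have \<phi>mult: "\<phi> (x \<otimes> y) = \<phi> x \<otimes>\<^bsub>A\<^esub> \<phi> y" if "x \<in> P" "y \<in> P" for x y
    using hom that by (auto simp: hom_def)
  have \<phi>one: "\<phi> \<one> = \<one>\<^bsub>A\<^esub>"
    using \<phi>mult[of \<one> \<one>] \<phi>A[of \<one>] by simp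
  have \<phi>pow: "\<phi> (x [^] k) = \<phi> x [^]\<^bsub>A\<^esub> k" if "x \<in> P" for x and k :: nat
  proof (induction k)
    case (Suc k)
    have "x [^] k \<in> P" using that by (intro subgroup_nat_pow_closed[OF P])
    then show ?case using Suc that \<phi>mult by simp
  qed (simp add: \<phi>one)
  define V where "V = (\<lambda>g. finprod A (\<lambda>C. \<phi> (d g C)) T)"
  have "V \<in> hom G A"
  proof (rule homI)
    show "V g \<in> carrier A" if "g \<in> carrier G" for g
      unfolding V_def using that dP \<phi>A by (intro A.finprod_closed) auto
    fix g h assume gh: "g \<in> carrier G" "h \<in> carrier G"
    have "V (g \<otimes> h) = finprod A (\<lambda>C. \<phi> (d g C) \<otimes>\<^bsub>A\<^esub> \<phi> (d h (C #> g))) T"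
      unfolding V_def by (rule A.finprod_cong') (use gh dmult dP \<phi>mult \<phi>A act in auto)
    also have "\<dots> = V g \<otimes>\<^bsub>A\<^esub> finprod A (\<lambda>C. \<phi> (d h (C #> g))) T"
      unfolding V_def by (rule A.finprod_multf) (use gh dP \<phi>A act in auto)
    also have "finprod A (\<lambda>C. \<phi> (d h (C #> g))) T = finprod A (\<lambda>C. \<phi> (d h C)) ((\<lambda>C. C #> g) ` T)"
      by (rule A.finprod_reindex[symmetric]) (use gh bij dP \<phi>A act in \<open>auto simp: bij_betw_def\<close>)
    also have "\<dots> = V h" using bij[OF gh(1)] by (simp add: V_def bij_betw_def)
    finally show "V (g \<otimes> h) = V g \<otimes>\<^bsub>A\<^esub> V h" .
  qed
  moreover have "V x = \<phi> x [^]\<^bsub>A\<^esub> card T" if x: "x \<in> P" for x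
    unfolding V_def
  proof (rule A.finprod_eq_power_of_cycles[OF finT bij])
    show xG: "x \<in> carrier G" using x PG by blast
    show "(\<lambda>C. \<phi> (d x C)) \<in> T \<rightarrow> carrier A" using xG dP \<phi>A by auto
    show "\<phi> x \<in> carrier A" using x \<phi>A by blast
    fix C k assume C: "C \<in> T" and cyc: "((\<lambda>C. C #> x) ^^ k) C = C"
    have iter: "((\<lambda>C. C #> x) ^^ i) C = C #> x [^] i" for i
      using C xG TG by (induction i) (auto simp: coset_mult_one actact)
    have prod: "finprod A (\<lambda>i. \<phi> (d x (C #> x [^] i))) {..<j} = \<phi> (d (x [^] j) C)" for j :: nat
    proof (induction j)
      case 0
      then show ?case using C TG rG by (simp add: d_def coset_mult_one \<phi>one)
    next
      case (Suc j)
      have "finprod A (\<lambda>i. \<phi> (d x (C #> x [^] i))) {..<Suc j}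
          = \<phi> (d x (C #> x [^] j)) \<otimes>\<^bsub>A\<^esub> \<phi> (d (x [^] j) C)"
        unfolding lessThan_Suc using C xG act dP \<phi>A Suc by (subst A.finprod_insert) auto
      also have "\<dots> = \<phi> (d (x [^] Suc j) C)"
        using C xG act dP \<phi>A dmult \<phi>mult by (simp add: A.m_comm)
      finally show ?case .
    qed
    have "finprod A (\<lambda>i. \<phi> (d x (((\<lambda>C. C #> x) ^^ i) C))) {..<k} = \<phi> (d (x [^] k) C)"
      by (simp add: iter prod)
    also have "d (x [^] k) C = r C \<otimes> x [^] k \<otimes> inv (r C)"
      using cyc iter by (simp add: d_def)
    also have "\<phi> \<dots> = \<phi> (x [^] k)"
    proof (rule stable)
      show "x [^] k \<in> P" using x by (intro subgroup_nat_pow_closed[OF P])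
      show "r C \<in> carrier G" using rG C .
      show "r C \<otimes> x [^] k \<otimes> inv (r C) \<in> P"
        using dP[OF C, of "x [^] k"] cyc iter xG by (simp add: d_def)
    qed
    also have "\<dots> = \<phi> x [^]\<^bsub>A\<^esub> k" using \<phi>pow x .
    finally show "finprod A (\<lambda>i. \<phi> (d x (((\<lambda>C. C #> x) ^^ i) C))) {..<k} = \<phi> x [^]\<^bsub>A\<^esub> k" .
  qed
  ultimately show ?thesis unfolding T_def by blast
qed

section \<open>Normal complements of Sylow subgroups\<close>

lemma (in bold_p_central_group) bold_p_central_subgroup:
  assumes "subgroup H G"
  shows "bold_p_central p (G\<lparr>carrier := H\<rparr>)"
  using central_if_bold_pow subgroup.mem_carrier[OF assms]
  by (auto simp: bold_p_central_def center_def nat_pow_consistent[symmetric])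

lemma (in bold_p_central_group) omega_comm_group:
  "comm_group (G\<lparr>carrier := {x \<in> carrier G. x [^] p = \<one>}\<rparr>)"
  by (rule group.group_comm_groupI[OF subgroup_imp_group[OF subgroup_omega]])
     (use center_commute[OF central_if_pow] in auto)

text \<open>Let the Sylow subgroup \<open>P\<close> have exponent \<open>p ^ Suc i\<close>. The map \<open>x \<mapsto> x [^] (p ^ i)\<close> is a
  nontrivial homomorphism on \<open>P\<close>. Its values have order dividing \<open>p\<close> and so are central in all of \<open>G\<close>;
  therefore it is constant on \<open>G\<close>-conjugate elements, and no information about the fusion of \<open>P\<close> in
  \<open>G\<close> is required. Its transfer is, on \<open>P\<close>, a power with exponent prime to \<open>p\<close>, hence nontrivial.\<close>

lemma (in bold_p_central_group) nontrivial_hom_to_omega: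
  assumes fin: "finite (carrier G)" and dvd: "p dvd order G"
  shows "\<exists>V \<in> hom G (G\<lparr>carrier := {x \<in> carrier G. x [^] p = \<one>}\<rparr>). \<exists>x \<in> carrier G. V x \<noteq> \<one>"
proof -
  define \<Omega> where "\<Omega> = {x \<in> carrier G. x [^] p = \<one>}"
  have "order G \<noteq> 0" using fin order_gt_0_iff_finite by simp
  then obtain m where m: "order G = p ^ multiplicity p (order G) * m" "\<not> p dvd m"
    using prime multiplicity_decompose'[of "order G" p] by (metis not_prime_unit)
  define a where "a = multiplicity p (order G)"
  obtain P where P: "subgroup P G" "card P = p ^ a"
    using sylow_thm[OF prime is_group m(1) fin] a_def by blast
  have PG: "x \<in> carrier G" if "x \<in> P" for x using subgroup.mem_carrier[OF P(1) that] .
  have a0: "a > 0" using m dvd by (metis a_def gr0I mult_1 power_0)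
  have finP: "finite P" using fin P(1) subgroup.subset finite_subset by blast
  interpret P: finite_p_group "G\<lparr>carrier := P\<rparr>" p a
    using subgroup_imp_group[OF P(1)] prime finP P(2)
    by (simp add: finite_p_group_def finite_p_group_axioms_def order_def)
  have pow: "x [^]\<^bsub>G\<lparr>carrier := P\<rparr>\<^esub> k = x [^] k" for x and k :: nat
    by (rule nat_pow_consistent[symmetric])
  define e where "e = (LEAST e. \<forall>x \<in> P. x [^] (p ^ e) = \<one>)"
  have "\<forall>x \<in> P. x [^] (p ^ a) = \<one>"
    using P.pow_order_eq_1 P(2) by (simp add: pow order_def)
  then have e: "x [^] (p ^ e) = \<one>" if "x \<in> P" for x
    using LeastI[of "\<lambda>e. \<forall>x \<in> P. x [^] (p ^ e) = \<one>" a] that unfolding e_def by blast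
  have "e \<noteq> 0"
  proof
    assume "e = 0"
    then have "P \<subseteq> {\<one>}" using e PG by fastforce
    then have "card P \<le> 1" using card_mono[of "{\<one>}" P] by simp
    moreover have "p ^ a > 1" using a0 prime prime_gt_1_nat one_less_power by blast
    ultimately show False using P(2) by simp
  qed
  then obtain i where i: "e = Suc i" using not0_implies_Suc by blast
  have "\<not> (\<forall>x \<in> P. x [^] (p ^ i) = \<one>)"
    using not_less_Least[of i "\<lambda>e. \<forall>x \<in> P. x [^] (p ^ e) = \<one>"] i e_def by simp
  then obtain x0 where x0: "x0 \<in> P" "x0 [^] (p ^ i) \<noteq> \<one>" by blast
  define \<phi> where "\<phi> = (\<lambda>x. x [^] (p ^ i))"
  have \<phi>\<Omega>: "\<phi> x \<in> \<Omega>" if "x \<in> P" for x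
    using that e PG by (simp add: \<phi>_def \<Omega>_def nat_pow_pow i mult.commute)
  have hom: "\<phi> \<in> hom (G\<lparr>carrier := P\<rparr>) (G\<lparr>carrier := \<Omega>\<rparr>)"
  proof (rule homI)
    fix x y assume "x \<in> carrier (G\<lparr>carrier := P\<rparr>)" "y \<in> carrier (G\<lparr>carrier := P\<rparr>)"
    then show "\<phi> (x \<otimes>\<^bsub>G\<lparr>carrier := P\<rparr>\<^esub> y) = \<phi> x \<otimes>\<^bsub>G\<lparr>carrier := \<Omega>\<rparr>\<^esub> \<phi> y"
      using P.pow_mult_distrib_if_bold_p_central[OF bold_p_central_subgroup[OF P(1)], of x y i] e
      by (simp add: pow \<phi>_def i)
  qed (use \<phi>\<Omega> in simp)
  have stable: "\<phi> (g \<otimes> x \<otimes> inv g) = \<phi> x" if "x \<in> P" "g \<in> carrier G" for x g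
  proof -
    have "\<phi> x \<in> center G" using \<phi>\<Omega>[OF that(1)] central_if_pow by (simp add: \<Omega>_def)
    then have "g \<otimes> \<phi> x \<otimes> inv g = \<phi> x \<otimes> g \<otimes> inv g" and "\<phi> x \<in> carrier G"
      using that(2) by (simp_all only: center_commute center_carrier)
    then have "g \<otimes> \<phi> x \<otimes> inv g = \<phi> x" using that(2) by (simp add: m_assoc)
    then show ?thesis using pow_conj that PG by (simp add: \<phi>_def)
  qed
  obtain V where V: "V \<in> hom G (G\<lparr>carrier := \<Omega>\<rparr>)"
    "\<forall>x \<in> P. V x = \<phi> x [^]\<^bsub>G\<lparr>carrier := \<Omega>\<rparr>\<^esub> card (rcosets P)"
    using transfer[OF P(1) fin omega_comm_group[folded \<Omega>_def] hom stable] by blast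
  have "card (rcosets P) * p ^ a = p ^ a * m"
    using lagrange[OF P(1)] P(2) m(1) a_def by simp
  then have "card (rcosets P) = m" using prime_gt_0_nat[OF prime] by (simp add: mult.commute)
  then have Vx0: "V x0 = \<phi> x0 [^] m" using V(2) x0 by (simp add: nat_pow_consistent[symmetric])
  have "V x0 \<noteq> \<one>"
  proof
    assume "V x0 = \<one>"
    moreover have *: "\<phi> x0 \<in> carrier G" "\<phi> x0 [^] p = \<one>" using \<phi>\<Omega>[OF x0(1)] by (auto simp: \<Omega>_def)
    ultimately have "ord (\<phi> x0) dvd m" "ord (\<phi> x0) dvd p" using Vx0 pow_eq_id by auto
    moreover have "coprime p m" using prime m(2) by (rule prime_imp_coprime)
    ultimately have "ord (\<phi> x0) = 1" by (metis coprime_common_divisor_nat)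
    then show False using * x0(2) ord_eq_1 by (simp add: \<phi>_def)
  qed
  then show ?thesis using V(1) x0(1) PG unfolding \<Omega>_def by blast
qed

text \<open>The commutator \<open>d\<close> of \<open>x\<close> and \<open>y\<close> descends the upper central series: if it is central modulo a
  term, then it is trivial modulo that term because the exponents \<open>s\<close> and \<open>m\<close> are coprime.\<close>

lemma (in group) coprime_exponents_commute_in_upper_central:
  assumes x: "x \<in> upper_central G n" "x [^] (s :: nat) = \<one>"
    and y: "y \<in> carrier G" "y [^] (m :: nat) = \<one>" and "coprime s m"
  shows "x \<otimes> y = y \<otimes> x"
proof -
  have xG: "x \<in> carrier G"
    using x(1) subgroup.mem_carrier[OF normal_imp_subgroup[OF upper_central_normal]] by blast
  define d where "d = y \<otimes> x \<otimes> inv (x \<otimes> y)"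
  have dG: "d \<in> carrier G" using xG y by (simp add: d_def)
  have step: "d \<in> upper_central G i" if d: "d \<in> upper_central G (Suc i)" for i
  proof -
    let ?Z = "upper_central G i"
    note Z = upper_central_normal[of i]
    interpret q: group_hom G "G Mod ?Z" "\<lambda>x. ?Z #> x" using Z by (rule coset_group_hom)
    have dc: "?Z #> d \<in> center (G Mod ?Z)" using d by simp
    have sw: "y \<otimes> x = d \<otimes> (x \<otimes> y)"
      using xG y m_assoc[of "y \<otimes> x" "inv (x \<otimes> y)" "x \<otimes> y"] by (simp add: d_def del: inv_mult_group)
    have "(?Z #> y) \<otimes>\<^bsub>G Mod ?Z\<^esub> (?Z #> x)
        = (?Z #> d) \<otimes>\<^bsub>G Mod ?Z\<^esub> ((?Z #> x) \<otimes>\<^bsub>G Mod ?Z\<^esub> (?Z #> y))"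
      using arg_cong[OF sw, of "\<lambda>z. ?Z #> z"] xG y(1) dG by (simp only: q.hom_mult m_closed)
    moreover have "(?Z #> x) [^]\<^bsub>G Mod ?Z\<^esub> s = \<one>\<^bsub>G Mod ?Z\<^esub>" "(?Z #> y) [^]\<^bsub>G Mod ?Z\<^esub> m = \<one>\<^bsub>G Mod ?Z\<^esub>"
      using q.hom_nat_pow[OF xG, of s] q.hom_nat_pow[OF y(1), of m] x(2) y(2) q.hom_one by simp_all
    ultimately have "?Z #> d = \<one>\<^bsub>G Mod ?Z\<^esub>"
      using q.H.coprime_central_commutator_trivial[OF q.hom_closed[OF xG] q.hom_closed[OF y(1)] dc]
        assms(5) by blast
    then show ?thesis using coset_eq_one_iff[OF Z dG] by blast
  qed
  have "d \<in> upper_central G n"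
  proof -
    let ?Z = "upper_central G n"
    note Z = upper_central_normal[of n]
    have "y \<otimes> x \<otimes> inv y \<in> ?Z" using Z x(1) y(1) by (simp add: normal_inv_iff)
    moreover have "inv x \<in> ?Z" using subgroup.m_inv_closed[OF normal_imp_subgroup[OF Z]] x(1) .
    ultimately have "y \<otimes> x \<otimes> inv y \<otimes> inv x \<in> ?Z"
      using subgroup.m_closed[OF normal_imp_subgroup[OF Z]] by blast
    then show ?thesis using xG y(1) by (simp add: d_def inv_mult_group m_assoc)
  qed
  then have "d \<in> upper_central G 0"
    by (induction n) (use step in blast)+
  then have "d = \<one>" by simp
  then show ?thesis using xG y(1) swap_commutator[OF xG y(1)] by (simp add: d_def)
qed

text \<open>For a prime \<open>q\<close> other than \<open>p\<close>, every \<open>q\<close>-subgroup of \<open>G\<close> lies in \<open>K\<close>. So the order of \<open>K\<close> is exactly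
  the part of the order of \<open>G\<close> that is prime to \<open>p\<close>, and \<open>K\<close> complements every Sylow \<open>p\<close>-subgroup by
  counting.\<close>

lemma (in group) p_nilpotent_if_normal_p'_subgroup:
  assumes prime: "Factorial_Ring.prime p" and fin: "finite (carrier G)"
    and K: "K \<lhd> G" "\<not> p dvd card K"
    and all: "\<And>y m. y \<in> carrier G \<Longrightarrow> coprime m p \<Longrightarrow> y [^] (m :: nat) = \<one> \<Longrightarrow> y \<in> K"
  shows "p_nilpotent p G"
proof -
  have Ksub: "subgroup K G" using K(1) by (rule normal_imp_subgroup)
  have KG: "K \<subseteq> carrier G" using Ksub by (rule subgroup.subset)
  have o0: "order G \<noteq> 0" using fin order_gt_0_iff_finite by simp
  then obtain m where m: "order G = p ^ multiplicity p (order G) * m" "\<not> p dvd m"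
    using prime multiplicity_decompose'[of "order G" p] by (metis not_prime_unit)
  define a where "a = multiplicity p (order G)"
  obtain P where P: "subgroup P G" "card P = p ^ a"
    using sylow_thm[OF prime is_group m(1) fin] a_def by blast
  have PG: "P \<subseteq> carrier G" using P(1) by (rule subgroup.subset)
  have m0: "m \<noteq> 0" using m(2) by (metis dvd_0_right)
  have cop: "coprime (card K) (p ^ a)"
    using prime K(2) prime_imp_coprime coprime_commute coprime_power_right_iff by metis
  have finK: "finite K" using KG fin finite_subset by blast
  have "m dvd card K"
  proof (rule multiplicity_le_imp_dvd[OF m0])
    fix q :: nat assume q: "Factorial_Ring.prime q"
    show "multiplicity q m \<le> multiplicity q (card K)"
    proof (cases "q = p")
      case True
      then show ?thesis using m(2) by (simp add: not_dvd_imp_multiplicity_0)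
    next
      case False
      let ?b = "multiplicity q m"
      have "q ^ ?b dvd order G" using m(1) multiplicity_dvd[of q m] by (metis dvd_mult)
      then obtain r where "order G = q ^ ?b * r" by (elim dvdE)
      then obtain Q where Q: "subgroup Q G" "card Q = q ^ ?b"
        using sylow_thm[OF q is_group _ fin] by blast
      have "y \<in> K" if "y \<in> Q" for y
      proof (rule all)
        show "y \<in> carrier G" using that Q(1) subgroup.mem_carrier by metis
        show "coprime (q ^ ?b) p" using q prime False by (simp add: primes_coprime)
        interpret Q: group "G\<lparr>carrier := Q\<rparr>" using subgroup_imp_group[OF Q(1)] .
        show "y [^] (q ^ ?b) = \<one>"
          using Q.pow_order_eq_1[of y] that Q(2) by (simp add: order_def nat_pow_consistent[symmetric])
      qed
      then have "Q \<subseteq> K" by blast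
      then have "subgroup Q (G\<lparr>carrier := K\<rparr>)" using Q(1) Ksub subgroup_incl by blast
      then have "card K = card (rcosets\<^bsub>G\<lparr>carrier := K\<rparr>\<^esub> Q) * card Q"
        using group.lagrange[OF subgroup_imp_group[OF Ksub], of Q] by (simp add: order_def)
      then have "card Q dvd card K" by simp
      then have "q ^ ?b dvd card K" using Q(2) by simp
      moreover have "card K \<noteq> 0" using finK subgroup.one_closed[OF Ksub] by auto
      ultimately show ?thesis using q by (intro multiplicity_geI) auto
    qed
  qed
  moreover have "card K dvd m"
  proof -
    have "card K dvd p ^ a * m" using lagrange[OF Ksub] m(1) a_def by (metis dvd_triv_right)
    then show ?thesis using cop by (simp add: coprime_dvd_mult_right_iff)
  qed
  ultimately have cardK: "card K = m" by (simp add: dvd_antisym)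
  have triv: "K \<inter> P = {\<one>}"
  proof -
    have "x = \<one>" if "x \<in> K" "x \<in> P" for x
    proof -
      interpret K: group "G\<lparr>carrier := K\<rparr>" using subgroup_imp_group[OF Ksub] .
      interpret P: group "G\<lparr>carrier := P\<rparr>" using subgroup_imp_group[OF P(1)] .
      have xG: "x \<in> carrier G" using that KG by blast
      have "x [^] card K = \<one>" "x [^] card P = \<one>"
        using K.pow_order_eq_1[of x] P.pow_order_eq_1[of x] that
        by (simp_all add: order_def nat_pow_consistent[symmetric])
      then have "ord x dvd card K" "ord x dvd p ^ a" using xG P(2) by (simp_all add: pow_eq_id)
      then have "ord x = 1" using cop by (metis coprime_common_divisor_nat)
      then show ?thesis using xG ord_eq_1 by blast
    qed
    then show ?thesis using subgroup.one_closed Ksub P(1) by blast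
  qed
  have "inj_on (\<lambda>(h, k). h \<otimes> k) (K \<times> P)"
  proof (rule inj_onI, clarify)
    fix h k h' k' assume hk: "h \<in> K" "k \<in> P" "h' \<in> K" "k' \<in> P" "h \<otimes> k = h' \<otimes> k'"
    then have G: "h \<in> carrier G" "k \<in> carrier G" "h' \<in> carrier G" "k' \<in> carrier G" using KG PG by auto
    have "inv h' \<otimes> h = inv h' \<otimes> (h \<otimes> k) \<otimes> inv k" using G by (simp add: m_assoc)
    also have "\<dots> = inv h' \<otimes> (h' \<otimes> k') \<otimes> inv k" using hk(5) by simp
    also have "\<dots> = k' \<otimes> inv k" using G by (simp add: m_assoc[symmetric])
    finally have eq: "inv h' \<otimes> h = k' \<otimes> inv k" .
    moreover have "inv h' \<otimes> h \<in> K" "k' \<otimes> inv k \<in> P"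
      using hk Ksub P(1) by (simp_all add: subgroup.m_closed subgroup.m_inv_closed)
    ultimately have "inv h' \<otimes> h = \<one>" using triv by auto
    then have "h' \<otimes> (inv h' \<otimes> h) = h'" using G by simp
    then have "h = h'" using G by (simp add: m_assoc[symmetric])
    then show "h = h' \<and> k = k'" using G hk(5) by simp
  qed
  then have "card (K <#> P) = card (K \<times> P)"
    unfolding set_mult_def by (subst card_image[symmetric]) (auto intro!: arg_cong[of _ _ card])
  also have "\<dots> = order G" using cardK P(2) m(1)[folded a_def] by (simp add: card_cartesian_product mult.commute)
  finally have "K <#> P = carrier G"
    using setmult_subset_G[OF KG PG] fin card_subset_eq order_def by metis
  then show ?thesis
    unfolding p_nilpotent_def sylow_subgroup_def using P K(1) triv a_def by blast
qed

text \<open>The candidate \<open>K\<close> for the complement is generated by the elements of order prime to \<open>p\<close>. These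
  centralize the hypercentral elements in question, so \<open>K\<close> satisfies \<open>bold_p_central\<close>. If \<open>p\<close> divided
  the order of \<open>K\<close>, the transfer would give a nontrivial homomorphism from \<open>K\<close> to a group of exponent
  \<open>p\<close>; but such a homomorphism kills all generators of \<open>K\<close>.\<close>

lemma (in group) p_nilpotent_if_bold_p_elements_hypercentral:
  assumes prime: "Factorial_Ring.prime p" and fin: "finite (carrier G)"
    and hyper: "\<And>x. x \<in> carrier G \<Longrightarrow> x [^] bold_p p = \<one> \<Longrightarrow> x \<in> upper_central G n"
  shows "p_nilpotent p G"
proof -
  define S where "S = {y \<in> carrier G. \<exists>m :: nat. coprime m p \<and> y [^] m = \<one>}"
  define K where "K = generate G S"
  have SG: "S \<subseteq> carrier G" by (auto simp: S_def)
  have K: "K \<lhd> G" unfolding K_def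
    by (rule normal_generateI[OF SG]) (auto simp: S_def pow_conj)
  have Ksub: "subgroup K G" using K by (rule normal_imp_subgroup)
  have KG: "K \<subseteq> carrier G" using Ksub by (rule subgroup.subset)
  have commute: "x \<otimes> y = y \<otimes> x"
    if x: "x \<in> carrier G" "x [^] bold_p p = \<one>" and y: "y \<in> K" for x y
  proof -
    have xZ: "x \<in> upper_central G n" using x hyper by blast
    have S: "x \<otimes> s = s \<otimes> x" if "s \<in> S" for s
    proof -
      obtain m where m: "s \<in> carrier G" "coprime m p" "s [^] (m :: nat) = \<one>"
        using \<open>s \<in> S\<close> by (auto simp: S_def)
      have "coprime (2 * 2) m" if "coprime 2 m"
        using that by (subst coprime_mult_left_iff) simp
      then have "coprime (bold_p p) m"
        using m(2) by (auto simp: bold_p_def coprime_commute)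
      then show ?thesis
        using coprime_exponents_commute_in_upper_central[OF xZ x(2) m(1,3)] by blast
    qed
    show ?thesis using y unfolding K_def
    proof (induction y rule: generate.induct)
      case one
      then show ?case using x by simp
    next
      case (incl h)
      then show ?case using S by blast
    next
      case (inv h)
      then have "h \<in> carrier G" "x \<otimes> h = h \<otimes> x" using S SG by auto
      then have "x \<otimes> inv h = inv h \<otimes> (h \<otimes> x) \<otimes> inv h" using x(1) by (simp add: m_assoc[symmetric])
      also have "\<dots> = inv h \<otimes> (x \<otimes> h) \<otimes> inv h" using \<open>x \<otimes> h = h \<otimes> x\<close> by simp
      also have "\<dots> = inv h \<otimes> x" using \<open>h \<in> carrier G\<close> x(1) by (simp add: m_assoc)
      finally show ?case .
    next
      case (eng h1 h2)
      then have "h1 \<in> carrier G" "h2 \<in> carrier G" using generate_in_carrier[OF SG] by auto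
      then show ?case using eng.IH x(1) by (metis m_assoc)
    qed
  qed
  interpret H: bold_p_central_group "G\<lparr>carrier := K\<rparr>" p
    unfolding bold_p_central_group_def bold_p_central_group_axioms_def bold_p_central_def center_def
    using subgroup_imp_group[OF Ksub] prime commute KG by (auto simp: nat_pow_consistent[symmetric])
  have "\<not> p dvd card K"
  proof
    assume "p dvd card K"
    moreover have "finite K" using KG fin finite_subset by blast
    ultimately obtain V x where
      V: "V \<in> hom (G\<lparr>carrier := K\<rparr>) (G\<lparr>carrier := {x \<in> K. x [^] p = \<one>}\<rparr>)"
      and x: "x \<in> K" "V x \<noteq> \<one>"
      using H.nontrivial_hom_to_omega by (auto simp: order_def nat_pow_consistent[symmetric])
    have "subgroup {x \<in> K. x [^] p = \<one>} (G\<lparr>carrier := K\<rparr>)"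
      using H.subgroup_omega by (simp add: nat_pow_consistent[symmetric])
    then have "group (G\<lparr>carrier := {x \<in> K. x [^] p = \<one>}\<rparr>)"
      using H.subgroup_imp_group by force
    then interpret V: group_hom "G\<lparr>carrier := K\<rparr>" "G\<lparr>carrier := {x \<in> K. x [^] p = \<one>}\<rparr>" V
      using V by (intro group_hom.intro group_hom_axioms.intro H.is_group)
    have Vs: "V s = \<one>" if sS: "s \<in> S" for s
    proof -
      obtain m where m: "s \<in> carrier G" "coprime m p" "s [^] (m :: nat) = \<one>"
        using sS by (auto simp: S_def)
      have s: "s \<in> K" using sS by (simp add: K_def generate.incl)
      then have Vs: "V s \<in> carrier G" "V s [^] p = \<one>" using V.hom_closed[of s] KG by auto
      have "V s [^] m = \<one>"
        using V.hom_nat_pow[of s m] V.hom_one s m(3) by (simp add: nat_pow_consistent[symmetric])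
      then have "ord (V s) dvd m" "ord (V s) dvd p" using Vs pow_eq_id by auto
      then have "ord (V s) = 1" using m(2) by (metis coprime_common_divisor_nat)
      then show ?thesis using Vs ord_eq_1 by blast
    qed
    have "V y = \<one>" if "y \<in> K" for y
      using that unfolding K_def
    proof (induction y rule: generate.induct)
      case one
      then show ?case using V.hom_one by simp
    next
      case (incl h)
      then show ?case using Vs by blast
    next
      case (inv h)
      then have "inv h \<in> S" using SG by (force simp: S_def nat_pow_inv)
      then show ?case using Vs by blast
    next
      case (eng h1 h2)
      then have "h1 \<in> K" "h2 \<in> K" by (auto simp: K_def)
      then show ?case using V.hom_mult[of h1 h2] eng.IH by simp
    qed
    then show False using x by blast
  qed
  moreover have "y \<in> K" if "y \<in> carrier G" "coprime m p" "y [^] m = \<one>" for y and m :: nat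
    unfolding K_def using that by (intro generate.incl) (auto simp: S_def)
  ultimately show ?thesis
    using p_nilpotent_if_normal_p'_subgroup[OF prime fin K] by blast
qed

theorem corollary14:
  fixes G :: "('a, 'b) monoid_scheme" and p n :: nat
  assumes "Factorial_Ring.prime p"
    and "group G"
    and "finite (carrier G)"
    and "n \<ge> 1"
    and "generate G {x \<in> carrier G. x [^]\<^bsub>G\<^esub> bold_p p = \<one>\<^bsub>G\<^esub>} \<subseteq> upper_central G n"
  shows "p_nilpotent p G"
  using group.p_nilpotent_if_bold_p_elements_hypercentral[OF assms(2,1,3)] assms(5)
    generate.incl[of _ "{x \<in> carrier G. x [^]\<^bsub>G\<^esub> bold_p p = \<one>\<^bsub>G\<^esub>}" G] by blast

end
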